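(* The solutions of the equation $$\left(\frac{x+y}{2}\right)^z = x^z - y^z$$ in positive integers $x, y, z$ are exactly the triples $(x,y,z) = (3k, k, 1)$ and $(x,y,z) = (5k, 3k, 2)$, where $k$ is a positive integer. *)

theory Defs imports Complex_Main begin

end

theory Submission imports Defs begin

text \<open>
  With \<open>a = x + y\<close> and \<open>d = x - y\<close> the equation reads \<open>a^n = (a + d)^n - (a - d)^n\<close>, and
  \<open>a\<close> and \<open>d\<close> may be taken coprime. The binomial expansion in powers of \<open>d\<close> gives
  \<open>a^n \<ge> 2 n a^(n-1) d\<close>, hence \<open>a \<ge> 2 n\<close>. Expanding in powers of \<open>a\<close> shows that \<open>a\<close> divides \<open>2 d^n\<close>,
  hence \<open>2\<close>, if \<open>n\<close> is odd, and that \<open>a^3\<close> divides \<open>2 n a d^(n-1)\<close>, hence \<open>a^2\<close> divides \<open>2 n\<close>,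
  if \<open>n \<ge> 3\<close> is even. For \<open>n \<ge> 3\<close> both contradict \<open>a \<ge> 2 n\<close>.
\<close>

text \<open>The difference \<open>U\<close> and sum \<open>V\<close> of the two powers satisfy a
  joint linear recursion: the next difference is \<open>a * U + d * V\<close>, the next sum
  \<open>a * V + d * U\<close>. So both bounds go through one induction. The extra factor
  \<open>a\<close> avoids the exponent \<open>n - 1\<close>, awkward at
  \<open>n = 0\<close>.\<close>

lemma power_add_diff_bounds:
  fixes a d :: "'a :: linordered_idom"
  assumes "0 \<le> d" "d \<le> a"
  shows "2 * of_nat n * a ^ n * d \<le> a * ((a + d) ^ n - (a - d) ^ n) \<and>
    2 * a ^ n \<le> (a + d) ^ n + (a - d) ^ n"
proof (induction n)
  case 0
  then show ?case by simp
next
  case (Suc n)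
  define U where "U = (a + d) ^ n - (a - d) ^ n"
  define V where "V = (a + d) ^ n + (a - d) ^ n"
  have U: "2 * of_nat n * a ^ n * d \<le> a * U" and V: "2 * a ^ n \<le> V"
    using Suc by (auto simp: U_def V_def)
  have "U \<ge> 0"
    unfolding U_def using assms by (simp add: power_mono)
  have U': "(a + d) ^ Suc n - (a - d) ^ Suc n = a * U + d * V"
    and V': "(a + d) ^ Suc n + (a - d) ^ Suc n = a * V + d * U"
    by (simp_all add: U_def V_def algebra_simps)
  have "a * (2 * of_nat n * a ^ n * d) \<le> a * (a * U)"
    using U assms by (intro mult_left_mono) auto
  moreover have "a * d * (2 * a ^ n) \<le> a * d * V"
    using V assms by (intro mult_left_mono) auto
  ultimately have "2 * of_nat (Suc n) * a ^ Suc n * d \<le> a * (a * U + d * V)"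
    by (simp add: algebra_simps)
  moreover have "a * (2 * a ^ n) \<le> a * V"
    using V assms by (intro mult_left_mono) auto
  then have "2 * a ^ Suc n \<le> a * V + d * U"
    using mult_nonneg_nonneg[OF \<open>0 \<le> d\<close> \<open>U \<ge> 0\<close>] by (simp add: mult.left_commute)
  ultimately show ?case
    unfolding U' V' by blast
qed

text \<open>The same recursion with \<open>a\<close> and \<open>d\<close> exchanged. Each clause
  feeds the next: \<open>a dvd U\<close> controls the sum modulo \<open>a ^ 2\<close>, which
  controls the difference modulo \<open>a ^ 3\<close>. The factor \<open>d\<close> again avoids
  \<open>n - 1\<close>.\<close>

lemma power_add_diff_expansion:
  fixes a d :: "'a :: comm_ring_1"
  shows "a ^ 3 dvd d * ((d + a) ^ n - (d - a) ^ n) - 2 * of_nat n * a * d ^ n \<and>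
    a dvd (d + a) ^ n - (d - a) ^ n \<and>
    a ^ 2 dvd (d + a) ^ n + (d - a) ^ n - 2 * d ^ n"
proof (induction n)
  case 0
  then show ?case by simp
next
  case (Suc n)
  define U where "U = (d + a) ^ n - (d - a) ^ n"
  define V where "V = (d + a) ^ n + (d - a) ^ n"
  have U: "a ^ 3 dvd d * U - 2 * of_nat n * a * d ^ n" and "a dvd U" and V: "a ^ 2 dvd V - 2 * d ^ n"
    using Suc by (auto simp: U_def V_def)
  obtain k l where k: "d * U - 2 * of_nat n * a * d ^ n = a ^ 3 * k" and l: "V - 2 * d ^ n = a ^ 2 * l"
    using U V unfolding dvd_def by blast
  obtain m where m: "U = a * m"
    using \<open>a dvd U\<close> unfolding dvd_def by blast
  have U': "(d + a) ^ Suc n - (d - a) ^ Suc n = d * U + a * V"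
    and V': "(d + a) ^ Suc n + (d - a) ^ Suc n = d * V + a * U"
    by (simp_all add: U_def V_def algebra_simps)
  have "d * (d * U + a * V) - 2 * of_nat (Suc n) * a * d ^ Suc n
      = d * (d * U - 2 * of_nat n * a * d ^ n) + a * d * (V - 2 * d ^ n)"
    by (simp add: algebra_simps)
  also have "\<dots> = a ^ 3 * (d * k + d * l)"
    unfolding k l by (simp add: algebra_simps power2_eq_square power3_eq_cube)
  finally have 1: "a ^ 3 dvd d * (d * U + a * V) - 2 * of_nat (Suc n) * a * d ^ Suc n"
    by simp
  have "d * V + a * U - 2 * d ^ Suc n = d * (V - 2 * d ^ n) + a * U"
    by (simp add: algebra_simps)
  also have "\<dots> = a ^ 2 * (d * l + m)"
    unfolding l m by (simp add: algebra_simps power2_eq_square)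
  finally have "a ^ 2 dvd d * V + a * U - 2 * d ^ Suc n"
    by simp
  moreover have "a dvd d * U + a * V"
    using \<open>a dvd U\<close> by simp
  ultimately show ?case
    unfolding U' V' using 1 by blast
qed

lemma power_neq_diff_powers_coprime:
  fixes a d :: int
  assumes "0 < d" "d < a" "coprime a d" "n \<ge> 3"
  shows "a ^ n \<noteq> (a + d) ^ n - (a - d) ^ n"
proof
  assume eq: "a ^ n = (a + d) ^ n - (a - d) ^ n"
  have "2 * int n * a ^ n * d \<le> a * a ^ n"
    using power_add_diff_bounds[of d a n] assms unfolding eq by simp
  then have "a ^ n * (2 * int n * d) \<le> a ^ n * a"
    by (simp add: mult_ac)
  then have "2 * int n * d \<le> a"
    using assms by simp
  moreover have "2 * int n * 1 \<le> 2 * int n * d"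
    using assms by (intro mult_left_mono) auto
  ultimately have ge: "2 * int n \<le> a"
    by linarith
  note exp = power_add_diff_expansion[of a d n]
  have cop: "coprime (a ^ k) (d ^ n)" for k
    using assms by simp
  show False
  proof (cases "even n")
    case True
    \<comment> \<open>For even \<open>n\<close> the right-hand side of \<open>eq\<close> is the
      difference in the expansion lemma.\<close>
    then have "(a - d) ^ n = (d - a) ^ n"
      by (metis minus_diff_eq power_minus_even)
    then have "a ^ 3 dvd d * a ^ n - 2 * int n * a * d ^ n"
      using exp eq by (simp add: add.commute)
    moreover have "a ^ 3 dvd d * a ^ n"
      using assms by (simp add: le_imp_power_dvd)
    ultimately have "a ^ 3 dvd 2 * int n * a * d ^ n"
      using dvd_diff_right_iff by blast
    then have "a * a ^ 2 dvd a * (2 * int n * d ^ n)"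
      by (simp add: power2_eq_square power3_eq_cube mult_ac)
    then have "a ^ 2 dvd 2 * int n * d ^ n"
      using assms by simp
    then have "a ^ 2 dvd 2 * int n"
      using cop coprime_dvd_mult_left_iff by blast
    \<comment> \<open>Divisibility gives \<open>a ^ 2 \<le> 2 * n\<close>, and \<open>ge\<close>
      gives \<open>2 * n \<le> a\<close>.\<close>
    then have "a ^ 2 \<le> a"
      using ge assms zdvd_imp_le[of "a ^ 2" "2 * int n"] by simp
    moreover have "a * 1 < a * a"
      using assms by (intro mult_strict_left_mono) auto
    ultimately show False
      by (simp add: power2_eq_square)
  next
    case False
    \<comment> \<open>For odd \<open>n\<close> the sign flips, so the sum clause applies, even
      modulo \<open>a ^ 2\<close>.\<close>
    then have "(a - d) ^ n = - ((d - a) ^ n)"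
      by (metis minus_diff_eq power_minus_odd)
    then have "a ^ 2 dvd a ^ n - 2 * d ^ n"
      using exp eq by (simp add: add.commute)
    moreover have "a ^ 2 dvd a ^ n"
      using assms by (simp add: le_imp_power_dvd)
    ultimately have "a ^ 2 dvd 2 * d ^ n"
      using dvd_diff_right_iff by blast
    then have "a ^ 2 dvd 2"
      using cop coprime_dvd_mult_left_iff by blast
    then have "a dvd 2"
      by (metis dvd_power dvd_trans zero_less_numeral)
    then have "a \<le> 2"
      by (simp add: zdvd_imp_le)
    then show False
      using ge assms by simp
  qed
qed

text \<open>The equation is homogeneous of degree \<open>n\<close>, so the gcd of \<open>a\<close>
  and \<open>d\<close> can be divided out.\<close>

lemma power_neq_diff_powers:
  fixes a d :: int
  assumes "0 < d" "d < a" "n \<ge> 3"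
  shows "a ^ n \<noteq> (a + d) ^ n - (a - d) ^ n"
proof
  assume eq: "a ^ n = (a + d) ^ n - (a - d) ^ n"
  define g where "g = gcd a d"
  have "g > 0"
    using assms by (simp add: g_def)
  obtain a' d' where a: "a = a' * g" and d: "d = d' * g" and "coprime a' d'"
    using gcd_coprime_exists[of a d] \<open>g > 0\<close> unfolding g_def by auto
  have "g ^ n * a' ^ n = g ^ n * ((a' + d') ^ n - (a' - d') ^ n)"
    using eq unfolding a d
    by (simp add: algebra_simps flip: power_mult_distrib)
  then have "a' ^ n = (a' + d') ^ n - (a' - d') ^ n"
    using \<open>g > 0\<close> by simp
  moreover have "0 < d'" "d' < a'"
    using assms \<open>g > 0\<close> unfolding a d by (auto simp: zero_less_mult_iff)
  ultimately show False
    using power_neq_diff_powers_coprime \<open>coprime a' d'\<close> assms by blast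
qed

theorem mainTheorem8:
  fixes x y z :: nat
  assumes "x > 0" and "y > 0" and "z > 0"
  shows "((real x + real y) / 2) ^ z = real x ^ z - real y ^ z \<longleftrightarrow>
    (\<exists>k::nat. k > 0 \<and> ((x, y, z) = (3 * k, k, 1) \<or> (x, y, z) = (5 * k, 3 * k, 2)))"
proof
  assume eq: "((real x + real y) / 2) ^ z = real x ^ z - real y ^ z"
  have "0 < ((real x + real y) / 2) ^ z"
    using assms by simp
  then have "real y ^ z < real x ^ z"
    using eq by linarith
  then have "y < x"
    by (metis of_nat_0_le_iff of_nat_less_iff power_less_imp_less_base)
  define a d where "a = int x + int y" and "d = int x - int y"
  have ad: "0 < d" "d < a"
    using \<open>y < x\<close> \<open>y > 0\<close> by (simp_all add: a_def d_def)
  \<comment> \<open>Multiplying by \<open>2 ^ z\<close> clears the denominator, so the equation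
    passes to the integers, where \<open>2 * x = a + d\<close> and
    \<open>2 * y = a - d\<close>.\<close>
  have "(real x + real y) ^ z = 2 ^ z * ((real x + real y) / 2) ^ z"
    by (simp add: power_divide)
  also have "\<dots> = (2 * real x) ^ z - (2 * real y) ^ z"
    unfolding eq by (simp add: power_mult_distrib right_diff_distrib)
  finally have "(real x + real y) ^ z = (2 * real x) ^ z - (2 * real y) ^ z" .
  then have "real_of_int ((int x + int y) ^ z) = real_of_int ((2 * int x) ^ z - (2 * int y) ^ z)"
    by simp
  then have "(int x + int y) ^ z = (2 * int x) ^ z - (2 * int y) ^ z"
    by (simp only: of_int_eq_iff)
  then have ieq: "a ^ z = (a + d) ^ z - (a - d) ^ z"
    by (simp add: a_def d_def)
  then have "z < 3"
    using power_neq_diff_powers[OF ad] by (meson not_less)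
  then consider "z = 1" | "z = 2"
    using \<open>z > 0\<close> by linarith
  then show "\<exists>k::nat. k > 0 \<and> ((x, y, z) = (3 * k, k, 1) \<or> (x, y, z) = (5 * k, 3 * k, 2))"
  proof cases
    case 1
    then have "x = 3 * y"
      using ieq by (simp add: a_def d_def)
    with 1 \<open>y > 0\<close> show ?thesis
      by auto
  next
    case 2
    \<comment> \<open>The difference of the squares of \<open>a + d\<close> and \<open>a - d\<close>
      is \<open>4 * a * d\<close>.\<close>
    then have "a * a = a * (4 * d)"
      using ieq by (simp add: power2_eq_square algebra_simps)
    then have "a = 4 * d"
      using ad by simp
    then have "3 * x = 5 * y"
      unfolding a_def d_def by presburger
    then have "3 dvd y"
      by presburger
    then obtain k where "y = 3 * k" ..
    moreover from this have "x = 5 * k"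
      using \<open>3 * x = 5 * y\<close> by simp
    ultimately show ?thesis
      using 2 \<open>y > 0\<close> by (intro exI[of _ k]) simp
  qed
next
  assume "\<exists>k::nat. k > 0 \<and> ((x, y, z) = (3 * k, k, 1) \<or> (x, y, z) = (5 * k, 3 * k, 2))"
  then show "((real x + real y) / 2) ^ z = real x ^ z - real y ^ z"
    by (auto simp: power2_eq_square)
qed

end
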